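(* Let $D_t=\sum_{h\ge 0}D_h t^h:\bigwedge M\to(\bigwedge M)[[t]]$ be the Schubert derivation on $\bigwedge M$, where $M$ is the free $\mathbb{Z}$-module with basis $(\epsilon^1,\epsilon^2,\ldots)$. Let $k\ge 1$, let $I=(1\leq i_1<i_2<\ldots<i_k)$ be a strictly increasing sequence of integers, and let $h\ge 0$. Then Pieri's formula holds: $$D_h(\epsilon^{i_1}\wedge\ldots\wedge\epsilon^{i_k})=\sum_{(h_j)\in H(I,h)} \epsilon^{i_1+h_1}\wedge\ldots\wedge\epsilon^{i_k+h_k},$$ where $H(I,h)$ denotes the set of all $k$-tuples $(h_1,\ldots,h_k)$ of non-negative integers such that $h_1+\ldots+h_k=h$ and $$1\leq i_1\leq i_1+h_1<i_2\leq i_2+h_2<\ldots \leq i_{k-1}+h_{k-1}< i_k .$$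
   Context: Let $M$ be a free $\mathbb{Z}$-module with countably infinite basis $\mathcal{E}=(\epsilon^1,\epsilon^2,\ldots)$, and let $\bigwedge M=\bigoplus_{k\ge 0}\bigwedge^k M$ be its exterior algebra over $\mathbb{Z}$, with $M=\bigwedge^1 M\subset \bigwedge M$. A Hasse-Schmidt derivation on $\bigwedge M$ is a $\mathbb{Z}$-algebra homomorphism $D_t=\sum_{i\ge 0}D_it^i:\bigwedge M\to(\bigwedge M)[[t]]$ with $D_i\in \mathrm{End}_{\mathbb{Z}}(\bigwedge M)$; that is, $D_t(\alpha\wedge\beta)=D_t(\alpha)\wedge D_t(\beta)$ for all $\alpha,\beta\in\bigwedge M$. The Schubert derivation is the unique Hasse-Schmidt derivation $D_t$ on $\bigwedge M$ such that $D_t(\epsilon^i)=\sum_{j\geq 0}\epsilon^{i+j}t^j$ for all $i\ge 1$; its coefficients are denoted $D_h$, $h\ge 0$. The chain of inequalities defining $H(I,h)$ means $i_j+h_j<i_{j+1}$ for $1\le j\le k-1$ (no upper bound is imposed on $h_k$ by it; for $k=1$ the condition is empty). *)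

theory Defs
  imports Complex_Main "HOL-Library.Poly_Mapping" "HOL-Computational_Algebra.Formal_Power_Series"
begin

section \<open>The exterior algebra of an abelian group\<close>

text \<open>
  The exterior algebra of a \<open>\<int>\<close>-module \<open>M\<close> is the tensor algebra of \<open>M\<close> modulo the two-sided
  ideal generated by the elements \<open>m \<otimes> m\<close>. Additive maps of abelian groups are
  \<open>\<int>\<close>-linear, so the tensor algebra over \<open>\<int>\<close> is the free ring on the symbols \<open>m \<in> M\<close>
  (integer combinations of words over \<open>M\<close>, multiplied by concatenation) modulo the relations
  \<open>[m + n] = [m] + [n]\<close>. Both quotients are taken at once below.
\<close>

datatype 'm free_monoid = Word (letters: "'m list")

instantiation free_monoid :: (type) monoid_add
begin

definition "0 = Word []"
definition "u + v = Word (letters u @ letters v)"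

instance
  by standard (simp_all add: zero_free_monoid_def plus_free_monoid_def)

end

type_synonym 'm free_ring = "'m free_monoid \<Rightarrow>\<^sub>0 int"

definition letter :: "'m \<Rightarrow> 'm free_ring" where
  "letter m = Poly_Mapping.single (Word [m]) 1"

inductive_set ext_ideal :: "('m::ab_group_add) free_ring set" where
  additive: "letter (m + n) - letter m - letter n \<in> ext_ideal"
| square: "letter m * letter m \<in> ext_ideal"
| zero: "0 \<in> ext_ideal"
| add: "p \<in> ext_ideal \<Longrightarrow> q \<in> ext_ideal \<Longrightarrow> p + q \<in> ext_ideal"
| mult: "p \<in> ext_ideal \<Longrightarrow> a * p * b \<in> ext_ideal"

definition ext_rel :: "('m::ab_group_add) free_ring \<Rightarrow> 'm free_ring \<Rightarrow> bool" where
  "ext_rel p q \<longleftrightarrow> p - q \<in> ext_ideal"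

lemma ext_ideal_uminus: "p \<in> ext_ideal \<Longrightarrow> - p \<in> ext_ideal"
  using ext_ideal.mult[of p "-1" 1] by simp

lemma ext_ideal_diff: "p \<in> ext_ideal \<Longrightarrow> q \<in> ext_ideal \<Longrightarrow> p - q \<in> ext_ideal"
  using ext_ideal.add[of p "- q"] ext_ideal_uminus by auto

lemma ext_rel_eqI: "p = q \<Longrightarrow> ext_rel p q"
  by (simp add: ext_rel_def ext_ideal.zero)

lemma ext_rel_mult:
  assumes "ext_rel p p'" "ext_rel q q'"
  shows "ext_rel (p * q) (p' * q')"
proof -
  have "p * q - p' * q' = 1 * (p - p') * q + p' * (q - q') * 1"
    by (simp add: algebra_simps)
  moreover have "1 * (p - p') * q \<in> ext_ideal" "p' * (q - q') * 1 \<in> ext_ideal"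
    using assms unfolding ext_rel_def by (auto intro!: ext_ideal.mult simp del: mult_1_left mult_1_right)
  ultimately show ?thesis
    unfolding ext_rel_def by (simp only: ext_ideal.add)
qed

quotient_type (overloaded) 'm exterior = "('m::ab_group_add) free_ring" / ext_rel
proof (rule equivpI)
  show "reflp (ext_rel :: 'm free_ring \<Rightarrow> _)"
    by (rule reflpI) (simp add: ext_rel_def ext_ideal.zero)
  show "symp (ext_rel :: 'm free_ring \<Rightarrow> _)"
  proof (rule sympI)
    fix p q :: "'m free_ring"
    assume "ext_rel p q"
    then show "ext_rel q p"
      using ext_ideal_uminus[of "p - q"] by (simp add: ext_rel_def)
  qed
  show "transp (ext_rel :: 'm free_ring \<Rightarrow> _)"
  proof (rule transpI)
    fix p q r :: "'m free_ring"
    assume "ext_rel p q" "ext_rel q r"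
    then show "ext_rel p r"
      using ext_ideal.add[of "p - q" "q - r"] by (simp add: ext_rel_def)
  qed
qed

lemma free_ring_sum:
  fixes p :: "'k \<Rightarrow>\<^sub>0 int"
  shows "p = (\<Sum>w\<in>Poly_Mapping.keys p. Poly_Mapping.single w (Poly_Mapping.lookup p w))"
  by (rule poly_mapping_eqI) (auto simp: lookup_sum lookup_single when_def in_keys_iff)

lemma lookup_mult_zero:
  fixes p q :: "'m free_ring"
  shows "Poly_Mapping.lookup (p * q) 0 = Poly_Mapping.lookup p 0 * Poly_Mapping.lookup q 0"
proof -
  let ?S = "\<lambda>p :: 'm free_ring.
    \<Sum>w\<in>Poly_Mapping.keys p. Poly_Mapping.single w (Poly_Mapping.lookup p w)"
  have iff: "0 = u + v \<longleftrightarrow> u = 0 \<and> v = 0" for u v :: "'m free_monoid"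
    by (cases u; cases v) (auto simp: zero_free_monoid_def plus_free_monoid_def)
  have "Poly_Mapping.lookup (Poly_Mapping.single u a * Poly_Mapping.single v b) (0 :: 'm free_monoid)
      = Poly_Mapping.lookup (Poly_Mapping.single u a) 0 * Poly_Mapping.lookup (Poly_Mapping.single v b) 0"
    for u v and a b :: int
    using iff[of u v] by (auto simp: mult_single lookup_single when_def)
  then have "Poly_Mapping.lookup (?S p * ?S q) 0
      = Poly_Mapping.lookup (?S p) 0 * Poly_Mapping.lookup (?S q) (0 :: 'm free_monoid)"
    by (simp only: sum_product lookup_sum)
  then show ?thesis
    by (simp only: free_ring_sum[symmetric])
qed

lemma one_notin_ext_ideal: "(1 :: ('m::ab_group_add) free_ring) \<notin> ext_ideal"
proof -
  have "Poly_Mapping.lookup p 0 = 0" if "p \<in> ext_ideal" for p :: "'m free_ring"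
    using that
  proof induction
    case (mult p a b)
    then show ?case by (simp add: lookup_mult_zero)
  next
    case (square m)
    have "Poly_Mapping.lookup (letter m) 0 = 0"
      by (simp add: letter_def lookup_single zero_free_monoid_def)
    then show ?case by (simp only: lookup_mult_zero)
  qed (simp_all add: lookup_add lookup_minus letter_def lookup_single zero_free_monoid_def)
  from this[of 1] show ?thesis
    by (auto simp: lookup_one)
qed

instantiation exterior :: (ab_group_add) ring_1
begin

lift_definition zero_exterior :: "'a exterior" is 0 .
lift_definition one_exterior :: "'a exterior" is 1 .
lift_definition plus_exterior :: "'a exterior \<Rightarrow> 'a exterior \<Rightarrow> 'a exterior" is "(+)"
  unfolding ext_rel_def by (simp only: add_diff_add ext_ideal.add)
lift_definition minus_exterior :: "'a exterior \<Rightarrow> 'a exterior \<Rightarrow> 'a exterior" is "(-)"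
proof -
  fix p p' q q' :: "'a free_ring"
  assume "ext_rel p p'" "ext_rel q q'"
  moreover have "p - q - (p' - q') = p - p' - (q - q')" by simp
  ultimately show "ext_rel (p - q) (p' - q')"
    unfolding ext_rel_def by (simp only: ext_ideal_diff)
qed
lift_definition uminus_exterior :: "'a exterior \<Rightarrow> 'a exterior" is "uminus"
  unfolding ext_rel_def by (simp only: minus_diff_minus ext_ideal_uminus)
lift_definition times_exterior :: "'a exterior \<Rightarrow> 'a exterior \<Rightarrow> 'a exterior" is "(*)"
  by (rule ext_rel_mult)

instance
proof
  have "\<not> ext_rel (0 :: 'a free_ring) 1"
    using one_notin_ext_ideal[where 'm = 'a] ext_ideal_uminus[of "- 1 :: 'a free_ring"]
    by (auto simp: ext_rel_def)
  then show "(0 :: 'a exterior) \<noteq> 1"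
    by transfer
qed (transfer, rule ext_rel_eqI, simp add: algebra_simps)+

end

text \<open>The inclusion of \<open>M\<close> into its exterior algebra; the wedge product is ring multiplication.\<close>

lift_definition emb :: "'m::ab_group_add \<Rightarrow> 'm exterior" is letter .

definition wedge :: "('m::ab_group_add) list \<Rightarrow> 'm exterior" where
  "wedge ms = prod_list (map emb ms)"


lemma emb_add: "emb (m + n) = emb m + emb n"
  by transfer (use ext_ideal.additive in \<open>simp add: ext_rel_def diff_diff_eq\<close>)

lemma emb_square: "emb m * emb m = 0"
  by transfer (simp add: ext_rel_def ext_ideal.square)

lemma emb_anticomm: "emb m * emb n = - (emb n * emb m)"
  using emb_square[of "m + n"]
  by (simp add: emb_add algebra_simps emb_square eq_neg_iff_add_eq_0)

lemma wedge_simps [simp]: "wedge [] = 1" "wedge (m # ms) = emb m * wedge ms"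
  by (simp_all add: wedge_def)

lemma abs_exterior_word: "abs_exterior (Poly_Mapping.single (Word ms) 1) = wedge ms"
proof (induction ms)
  case Nil
  then show ?case
    by (simp add: one_exterior_def single_one flip: zero_free_monoid_def)
next
  case (Cons m ms)
  have "Poly_Mapping.single (Word (m # ms)) 1
      = letter m * Poly_Mapping.single (Word ms) 1"
    by (simp add: letter_def mult_single plus_free_monoid_def)
  then show ?case
    using Cons by (simp add: emb.abs_eq flip: times_exterior.abs_eq)
qed

lemma exterior_induct [case_names zero wedge diff]:
  assumes "P 0" "\<And>ms. P (wedge ms)" "\<And>x y. P x \<Longrightarrow> P y \<Longrightarrow> P (x - y)"
  shows "P x"
proof (induction x rule: exterior.abs_induct)
  case (1 p)
  show ?case
    using subset_UNIV
  proof (induction p rule: frag_induction)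
    case (one w)
    then show ?case
      using assms(2) by (cases w) (simp add: abs_exterior_word)
  next
    case (diff a b)
    then show ?case
      using assms(3) by (simp flip: minus_exterior.abs_eq)
  qed (use assms(1) in \<open>simp add: zero_exterior_def\<close>)
qed

text \<open>The universal property of the exterior algebra.\<close>

theorem exterior_universal:
  fixes f :: "'m::ab_group_add \<Rightarrow> 'r::ring_1"
  assumes add: "\<And>m n. f (m + n) = f m + f n" and square: "\<And>m. f m * f m = 0"
  shows "\<exists>!F. F 1 = 1 \<and> (\<forall>x y. F (x + y) = F x + F y) \<and>
    (\<forall>x y. F (x * y) = F x * F y) \<and> (\<forall>m. F (emb m) = f m)"
proof (rule ex_ex1I)
  define ev :: "'m free_ring \<Rightarrow> 'r" where
    "ev p = (\<Sum>w\<in>Poly_Mapping.keys p.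
      of_int (Poly_Mapping.lookup p w) * prod_list (map f (letters w)))" for p
  have ev_alt: "ev p = (\<Sum>w\<in>S. of_int (Poly_Mapping.lookup p w) * prod_list (map f (letters w)))"
    if "finite S" "Poly_Mapping.keys p \<subseteq> S" for p S
    unfolding ev_def by (rule sum.mono_neutral_left) (use that in \<open>auto simp: in_keys_iff\<close>)
  have ev_0: "ev 0 = 0"
    by (simp add: ev_def)
  have ev_diff: "ev (p - q) = ev p - ev q" for p q
  proof -
    let ?S = "Poly_Mapping.keys p \<union> Poly_Mapping.keys q"
    have "Poly_Mapping.keys (p - q) \<subseteq> ?S"
      by (auto simp: in_keys_iff lookup_minus)
    then show ?thesis
      by (simp add: ev_alt[of ?S] lookup_minus algebra_simps sum_subtractf)
  qed
  have ev_add: "ev (p + q) = ev p + ev q" for p q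
    using ev_diff[of "p + q" q] by (simp add: algebra_simps)
  have ev_word: "ev (Poly_Mapping.single w 1) = prod_list (map f (letters w))" for w
    by (simp add: ev_def)
  have ev_mult_word: "ev (Poly_Mapping.single v 1 * q) = ev (Poly_Mapping.single v 1) * ev q" for v q
    using subset_UNIV
  proof (induction q rule: frag_induction)
    case (one w)
    then show ?case by (simp add: mult_single ev_word plus_free_monoid_def)
  qed (simp_all add: ev_0 ev_diff right_diff_distrib)
  have ev_mult: "ev (p * q) = ev p * ev q" for p q
    using subset_UNIV
    by (induction p rule: frag_induction)
       (simp_all add: ev_0 ev_diff left_diff_distrib ev_mult_word)
  have ev_letter: "ev (letter m) = f m" for m
    by (simp add: letter_def ev_word)
  have ev_ideal: "ev p = 0" if "p \<in> ext_ideal" for p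
    using that
    by induction (simp_all add: ev_0 ev_diff ev_add ev_mult ev_letter add square)
  define F where "F x = ev (rep_exterior x)" for x
  have F_abs: "F (abs_exterior p) = ev p" for p
  proof -
    have "ext_rel (rep_exterior (abs_exterior p)) p"
      using Quotient_rep_abs[OF Quotient_exterior, of p]
      by (simp add: ext_rel_def ext_ideal.zero)
    then have "ev (rep_exterior (abs_exterior p) - p) = 0"
      using ev_ideal by (simp add: ext_rel_def)
    then show ?thesis by (simp add: ev_diff F_def)
  qed
  have "F 1 = 1"
    using ev_word[of 0] by (simp add: one_exterior_def F_abs) (simp add: zero_free_monoid_def)
  moreover have "F (x + y) = F x + F y" for x y
    by (induction x rule: exterior.abs_induct; induction y rule: exterior.abs_induct)
       (simp add: plus_exterior.abs_eq F_abs ev_add)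
  moreover have "F (x * y) = F x * F y" for x y
    by (induction x rule: exterior.abs_induct; induction y rule: exterior.abs_induct)
       (simp add: times_exterior.abs_eq F_abs ev_mult)
  moreover have "F (emb m) = f m" for m
    by (simp add: emb.abs_eq F_abs ev_letter)
  ultimately show "\<exists>F. F 1 = 1 \<and> (\<forall>x y. F (x + y) = F x + F y) \<and>
      (\<forall>x y. F (x * y) = F x * F y) \<and> (\<forall>m. F (emb m) = f m)"
    by blast
next
  fix F G :: "'m exterior \<Rightarrow> 'r"
  assume F: "F 1 = 1 \<and> (\<forall>x y. F (x + y) = F x + F y) \<and>
      (\<forall>x y. F (x * y) = F x * F y) \<and> (\<forall>m. F (emb m) = f m)"
    and G: "G 1 = 1 \<and> (\<forall>x y. G (x + y) = G x + G y) \<and>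
      (\<forall>x y. G (x * y) = G x * G y) \<and> (\<forall>m. G (emb m) = f m)"
  have H_diff: "H (x - y) = H x - H y" if "\<forall>x y. H (x + y) = H x + H y"
    for H :: "'m exterior \<Rightarrow> 'r" and x y
    using that[rule_format, of "x - y" y] by (simp add: algebra_simps)
  have "F x = G x" for x
  proof (induction x rule: exterior_induct)
    case zero
    have "H 0 = 0" if "\<forall>x y. H (x + y) = H x + H y" for H :: "'m exterior \<Rightarrow> 'r"
      using H_diff[OF that, of 0 0] by simp
    from this[of F] this[of G] show ?case using F G by simp
  next
    case (wedge ms)
    then show ?case by (induction ms) (use F G in simp_all)
  next
    case (diff x y)
    then show ?case using F G by (simp add: H_diff)
  qed
  then show "F = G" by blast
qed


section \<open>Hasse-Schmidt derivations and the Schubert derivation\<close>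

text \<open>
  Ring homomorphisms are automatically \<open>\<int>\<close>-linear. The coefficient \<open>D\<^sub>h\<close> of a map \<open>D\<close> into
  power series is \<open>\<lambda>\<alpha>. fps_nth (D \<alpha>) h\<close>.
\<close>

definition hasse_schmidt :: "(('m::ab_group_add) exterior \<Rightarrow> 'm exterior fps) \<Rightarrow> bool" where
  "hasse_schmidt D \<longleftrightarrow>
     D 1 = 1 \<and> (\<forall>\<alpha> \<beta>. D (\<alpha> + \<beta>) = D \<alpha> + D \<beta>) \<and> (\<forall>\<alpha> \<beta>. D (\<alpha> * \<beta>) = D \<alpha> * D \<beta>)"

text \<open>A basis \<open>(\<epsilon> 1, \<epsilon> 2, \<dots>)\<close>; the value \<open>\<epsilon> 0\<close> is irrelevant.\<close>

definition Z_basis :: "(int \<Rightarrow> 'm \<Rightarrow> 'm) \<Rightarrow> (nat \<Rightarrow> 'm::ab_group_add) \<Rightarrow> bool" where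
  "Z_basis scale \<epsilon> \<longleftrightarrow>
     inj_on \<epsilon> {1..} \<and> \<not> module.dependent scale (\<epsilon> ` {1..}) \<and>
     module.span scale (\<epsilon> ` {1..}) = UNIV"

definition schubert_derivation ::
    "(nat \<Rightarrow> 'm::ab_group_add) \<Rightarrow> ('m exterior \<Rightarrow> 'm exterior fps) \<Rightarrow> bool" where
  "schubert_derivation \<epsilon> D \<longleftrightarrow>
     hasse_schmidt D \<and> (\<forall>i\<ge>1. D (emb (\<epsilon> i)) = Abs_fps (\<lambda>j. emb (\<epsilon> (i + j))))"

lemma convolution_alternating_zero:
  fixes x :: "nat \<Rightarrow> 'r::ring"
  assumes "\<And>a b. x a * x b = - (x b * x a)" "\<And>a. x a * x a = 0"
  shows "(\<Sum>a = 0..n. x a * x (n - a)) = 0"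
  using assms
proof (induction n arbitrary: x rule: less_induct)
  case (less n)
  consider "n = 0" | "n = 1" | m where "n = Suc (Suc m)"
    by (metis One_nat_def not0_implies_Suc)
  then show ?case
  proof cases
    case 1
    then show ?thesis using less.prems(2) by simp
  next
    case 2
    have "x 0 * x 1 + x 1 * x 0 = 0"
      by (subst less.prems(1)[of 0 1]) (rule left_minus)
    with 2 show ?thesis by simp
  next
    case 3
    have "(\<Sum>a = 0..n. x a * x (n - a))
        = x 0 * x n + (\<Sum>a = 0..m. x (Suc a) * x (Suc (m - a))) + x n * x 0"
    proof -
      have "(\<Sum>a = 0..n. x a * x (n - a)) = (\<Sum>a = 0..Suc m. x a * x (n - a)) + x n * x 0"
        by (simp add: 3)
      also have "(\<Sum>a = 0..Suc m. x a * x (n - a)) = x 0 * x n + (\<Sum>a = 0..m. x (Suc a) * x (n - Suc a))"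
        by (subst sum.atLeast0_atMost_Suc_shift) simp
      also have "(\<Sum>a = 0..m. x (Suc a) * x (n - Suc a)) = (\<Sum>a = 0..m. x (Suc a) * x (Suc (m - a)))"
        by (rule sum.cong) (auto simp: 3 Suc_diff_le)
      finally show ?thesis .
    qed
    moreover have "(\<Sum>a = 0..m. x (Suc a) * x (Suc (m - a))) = 0"
      by (rule less.IH[of m "\<lambda>a. x (Suc a)", unfolded diff_Suc_Suc]) (auto simp: 3 intro: less.prems)
    moreover have "x 0 * x n + x n * x 0 = 0"
      by (subst less.prems(1)[of 0 n]) (rule left_minus)
    ultimately show ?thesis by (simp only: add_0_right)
  qed
qed

text \<open>
  The Schubert derivation is determined by its values on the basis, and it exists.
\<close>

theorem schubert_derivation_ex1:
  fixes scale :: "int \<Rightarrow> 'm::ab_group_add \<Rightarrow> 'm"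
  assumes "module scale" and basis: "Z_basis scale \<epsilon>"
  shows "\<exists>!D. schubert_derivation \<epsilon> D"
proof -
  interpret module scale by fact
  define B where "B = \<epsilon> ` {1..}"
  have inj: "inj_on \<epsilon> {1..}" and indep: "independent B" and span: "span B = UNIV"
    using basis by (auto simp: Z_basis_def B_def)
  define \<sigma> where "\<sigma> j m = (\<Sum>b\<in>{b. representation B m b \<noteq> 0}.
      scale (representation B m b) (\<epsilon> (the_inv_into {1..} \<epsilon> b + j)))" for j m
  have \<sigma>_alt: "\<sigma> j m = (\<Sum>b\<in>S. scale (representation B m b) (\<epsilon> (the_inv_into {1..} \<epsilon> b + j)))"
    if "finite S" "{b. representation B m b \<noteq> 0} \<subseteq> S" for S j m
    unfolding \<sigma>_def by (rule sum.mono_neutral_left) (use that in auto)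
  have \<sigma>_add: "\<sigma> j (m + n) = \<sigma> j m + \<sigma> j n" for j m n
  proof -
    let ?S = "{b. representation B m b \<noteq> 0} \<union> {b. representation B n b \<noteq> 0}"
    have rep: "representation B (m + n) b = representation B m b + representation B n b" for b
      by (simp add: representation_add indep span)
    then have "finite ?S" "{b. representation B (m + n) b \<noteq> 0} \<subseteq> ?S"
      by (auto simp: finite_representation)
    then show ?thesis
      by (simp add: \<sigma>_alt[of ?S] rep scale_left_distrib sum.distrib)
  qed
  have \<sigma>_basis: "\<sigma> j (\<epsilon> i) = \<epsilon> (i + j)" if "i \<ge> 1" for i j
  proof -
    have "representation B (\<epsilon> i) = (\<lambda>v. if v = \<epsilon> i then 1 else 0)"
      using that indep by (intro representation_basis) (auto simp: B_def)
    then show ?thesis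
      using that the_inv_into_f_f[OF inj, of i] by (simp add: \<sigma>_def)
  qed
  define f where "f m = Abs_fps (\<lambda>j. emb (\<sigma> j m))" for m
  have f_add: "f (m + n) = f m + f n" for m n
    by (rule fps_ext) (simp add: f_def \<sigma>_add emb_add)
  have f_square: "f m * f m = 0" for m
  proof (rule fps_ext)
    fix n
    have "(\<Sum>a = 0..n. emb (\<sigma> a m) * emb (\<sigma> (n - a) m)) = 0"
      by (rule convolution_alternating_zero) (rule emb_anticomm emb_square)+
    then show "fps_nth (f m * f m) n = fps_nth 0 n"
      by (simp add: f_def fps_mult_nth)
  qed
  have f_basis: "f (\<epsilon> i) = Abs_fps (\<lambda>j. emb (\<epsilon> (i + j)))" if "i \<ge> 1" for i
    using that by (simp add: f_def \<sigma>_basis)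
  have "schubert_derivation \<epsilon> D \<longleftrightarrow> hasse_schmidt D \<and> (\<forall>m. D (emb m) = f m)" for D
  proof
    assume D: "schubert_derivation \<epsilon> D"
    then have add: "D (x + y) = D x + D y" for x y
      by (simp add: schubert_derivation_def hasse_schmidt_def)
    have "additive (\<lambda>m. D (emb m) - f m)"
      by (simp add: additive_def add emb_add f_add)
    then interpret A: additive "\<lambda>m. D (emb m) - f m" .
    have scale_zero: "D (emb (scale c m)) - f (scale c m) = 0" if "D (emb m) - f m = 0" for c m
    proof (induction c rule: int_induct[of _ 0])
      case base
      show ?case using A.zero by simp
    next
      case (step1 c)
      then show ?case using that A.add[of "scale c m" m] by (simp add: scale_left_distrib)
    next
      case (step2 c)
      then show ?case using that A.diff[of "scale c m" m] by (simp add: scale_left_diff_distrib)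
    qed
    have "D (emb m) - f m = 0" for m
    proof -
      have "m \<in> span B" using span by simp
      then show ?thesis
      proof (induction rule: span_induct_alt)
        case base
        show ?case using A.zero by simp
      next
        case (step c x y)
        then have "D (emb x) - f x = 0"
          using D f_basis by (auto simp: schubert_derivation_def B_def)
        then show ?case
          using step scale_zero[of x c] A.add[of "scale c x" y] by simp
      qed
    qed
    then show "hasse_schmidt D \<and> (\<forall>m. D (emb m) = f m)"
      using D by (simp add: schubert_derivation_def)
  qed (simp add: schubert_derivation_def f_basis)
  then show ?thesis
    using exterior_universal[of f, OF f_add f_square] by (simp add: hasse_schmidt_def)
qed

text \<open>
  The tuples \<open>(h\<^sub>1, \<dots>, h\<^sub>k)\<close> with sum \<open>h\<close> and \<open>i\<^sub>j \<le> i\<^sub>j + h\<^sub>j < i\<^bsub>j+1\<^esub>\<close>. There is no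
  upper bound on \<open>h\<^sub>k\<close>.
\<close>

definition pieri_set :: "nat list \<Rightarrow> nat \<Rightarrow> nat list set" where
  "pieri_set I h =
     {hs. length hs = length I \<and> sum_list hs = h \<and>
          (\<forall>j. Suc j < length I \<longrightarrow> I ! j + hs ! j < I ! Suc j)}"

end

theory Submission
  imports Defs
begin

text \<open>
  Peel off the first factor. For \<open>i < j\<close> the series \<open>D (\<epsilon> i)\<close> splits into its terms
  \<open>\<epsilon> (i + a) t^a\<close> with \<open>i + a < j\<close> and the tail \<open>t^(j - i) D (\<epsilon> j)\<close>. The tail contributes
  nothing to \<open>D (\<epsilon> i \<and> \<epsilon> j \<and> \<dots>)\<close>, since \<open>D (\<epsilon> j) D (\<epsilon> j \<and> \<dots>) = D (\<epsilon> j \<and> \<epsilon> j \<and> \<dots>) = 0\<close>.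
  The remaining terms are exactly those that the inequality \<open>i + h\<^sub>1 < j\<close> allows.
\<close>

lemma pieri_set_Nil: "pieri_set [] h = (if h = 0 then {[]} else {})"
  by (auto simp: pieri_set_def)

lemma pieri_set_single: "pieri_set [i] h = {[h]}"
  by (auto simp: pieri_set_def length_Suc_conv)

text \<open>Only the inequality at index 0 involves the head \<open>a\<close>; the others, shifted
  by one index, are the conditions on the tail. The bound \<open>a \<le> h\<close> keeps the
  subtraction \<open>h - a\<close> exact.\<close>

lemma pieri_set_Cons_Cons:
  "pieri_set (i # j # I) h =
     (\<Union>a\<in>{a. a \<le> h \<and> i + a < j}. (#) a ` pieri_set (j # I) (h - a))"
proof -
  have "a # hs \<in> pieri_set (i # j # I) h \<longleftrightarrow>
      a \<le> h \<and> i + a < j \<and> hs \<in> pieri_set (j # I) (h - a)" for a hs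
    by (auto simp: pieri_set_def nth_Cons split: nat.splits)
  moreover have "[] \<notin> pieri_set (i # j # I) h"
    by (simp add: pieri_set_def)
  ultimately have "hs \<in> pieri_set (i # j # I) h \<longleftrightarrow>
      hs \<in> (\<Union>a\<in>{a. a \<le> h \<and> i + a < j}. (#) a ` pieri_set (j # I) (h - a))" for hs
    by (cases hs) auto
  then show ?thesis
    by blast
qed

lemma finite_pieri_set: "finite (pieri_set I h)"
proof (induction I arbitrary: h rule: induct_list012)
  case (3 i j I)
  then show ?case
    by (simp add: pieri_set_Cons_Cons)
qed (simp_all add: pieri_set_Nil pieri_set_single)

text \<open>Tuples with different heads are distinct and prepending a fixed head is injective, so no
  term is counted twice.\<close>

lemma sum_pieri_set_Cons_Cons:
  "(\<Sum>hs\<in>pieri_set (i # j # I) h. g hs) =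
     (\<Sum>a | a \<le> h \<and> i + a < j. \<Sum>hs\<in>pieri_set (j # I) (h - a). g (a # hs))"
  unfolding pieri_set_Cons_Cons
  by (subst sum.UNION_disjoint) (auto simp: finite_pieri_set sum.reindex)

context
  fixes \<epsilon> :: "nat \<Rightarrow> 'm::ab_group_add"
    and D :: "'m exterior \<Rightarrow> 'm exterior fps"
  assumes D: "schubert_derivation \<epsilon> D"
begin

lemma schubert_mult: "D (x * y) = D x * D y"
  using D by (simp add: schubert_derivation_def hasse_schmidt_def)

lemma schubert_zero: "D 0 = 0"
proof -
  have "D (0 + 0) = D 0 + D 0"
    using D unfolding schubert_derivation_def hasse_schmidt_def by blast
  then show ?thesis
    by simp
qed

lemma schubert_basis_mult_nth:
  assumes "i \<ge> 1"
  shows "fps_nth (D (emb (\<epsilon> i) * x)) h = (\<Sum>a\<le>h. emb (\<epsilon> (i + a)) * fps_nth (D x) (h - a))"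
  using D assms
  by (simp add: schubert_mult schubert_derivation_def fps_mult_nth atLeast0AtMost)

text \<open>The factor \<open>x\<close> enters only through
  \<open>emb (\<epsilon> j) * x = 0\<close>, so the tail vanishes without any formula for
  \<open>D x\<close>.\<close>

lemma schubert_basis_mult_nth_truncated:
  assumes "i \<ge> 1" "i < j" and zero: "emb (\<epsilon> j) * x = 0"
  shows "fps_nth (D (emb (\<epsilon> i) * x)) h =
    (\<Sum>a | a \<le> h \<and> i + a < j. emb (\<epsilon> (i + a)) * fps_nth (D x) (h - a))"
proof -
  let ?g = "\<lambda>a. emb (\<epsilon> (i + a)) * fps_nth (D x) (h - a)"
  let ?L = "{a. a \<le> h \<and> i + a < j}" and ?U = "{a. a \<le> h \<and> j \<le> i + a}"
  have tail: "sum ?g ?U = 0"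
  \<comment> \<open>If \<open>h < j - i\<close>, truncated subtraction makes
    \<open>{..h - (j - i)}\<close> equal to \<open>{0}\<close> while \<open>?U\<close> is empty, so
    the shift of indices needs \<open>j - i \<le> h\<close>.\<close>
  proof (cases "j - i \<le> h")
    case True
    have "sum ?g ?U = (\<Sum>b\<le>h - (j - i). emb (\<epsilon> (j + b)) * fps_nth (D x) (h - (j - i) - b))"
      by (rule sum.reindex_bij_witness[where i = "\<lambda>b. b + (j - i)" and j = "\<lambda>a. a - (j - i)"])
         (use True assms in \<open>auto simp: algebra_simps\<close>)
    also have "\<dots> = fps_nth (D (emb (\<epsilon> j) * x)) (h - (j - i))"
      using assms by (intro schubert_basis_mult_nth[symmetric]) simp
    finally show ?thesis
      by (simp add: zero schubert_zero)
  next
    case False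
    then have "?U = {}" by auto
    then show ?thesis by (simp only: sum.empty)
  qed
  have "{..h} = ?L \<union> ?U" by auto
  then have "fps_nth (D (emb (\<epsilon> i) * x)) h = sum ?g (?L \<union> ?U)"
    using assms by (simp only: schubert_basis_mult_nth)
  also have "\<dots> = sum ?g ?L + sum ?g ?U"
    by (rule sum.union_disjoint) auto
  finally show ?thesis
    by (simp add: tail)
qed

lemma schubert_wedge_nth:
  assumes "\<forall>i\<in>set I. i \<ge> 1" "sorted_wrt (<) I"
  shows "fps_nth (D (wedge (map \<epsilon> I))) h =
    (\<Sum>hs\<in>pieri_set I h. wedge (map \<epsilon> (map2 (+) I hs)))"
  using assms
\<comment> \<open>The bound on a head comes from the entry after it, so the induction step exposes
  two leading entries; a single entry has no bound and takes the whole degree.\<close>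
proof (induction I arbitrary: h rule: induct_list012)
  case 1
  have "D 1 = 1"
    using D by (simp add: schubert_derivation_def hasse_schmidt_def)
  then show ?case
    by (simp add: pieri_set_Nil)
next
  case (2 i)
  then show ?case
    using D by (simp add: pieri_set_single schubert_derivation_def)
next
  case (3 i j I)
  \<comment> \<open>Regrouping the product exposes the square of
    \<open>emb (\<epsilon> j)\<close>.\<close>
  have "emb (\<epsilon> j) * wedge (map \<epsilon> (j # I)) = 0"
    by (simp add: emb_square flip: mult.assoc)
  then have "fps_nth (D (wedge (map \<epsilon> (i # j # I)))) h =
      (\<Sum>a | a \<le> h \<and> i + a < j. emb (\<epsilon> (i + a)) * fps_nth (D (wedge (map \<epsilon> (j # I)))) (h - a))"
    using 3 schubert_basis_mult_nth_truncated[of i j "wedge (map \<epsilon> (j # I))" h] by simp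
  also have "\<dots> = (\<Sum>hs\<in>pieri_set (i # j # I) h. wedge (map \<epsilon> (map2 (+) (i # j # I) hs)))"
  proof -
    \<comment> \<open>The sum calls for the induction hypothesis in every degree
      \<open>h - a\<close>, hence for arbitrary \<open>n\<close>.\<close>
    have "fps_nth (D (wedge (map \<epsilon> (j # I)))) n =
        (\<Sum>hs\<in>pieri_set (j # I) n. wedge (map \<epsilon> (map2 (+) (j # I) hs)))" for n
      using 3 by simp
    then show ?thesis
      by (simp only: sum_pieri_set_Cons_Cons)
         (simp only: sum_distrib_left zip_Cons_Cons list.map prod.case wedge_simps)
  qed
  finally show ?case .
qed

end

theorem theorem2p4:
  fixes scale :: "int \<Rightarrow> 'm::ab_group_add \<Rightarrow> 'm"
    and \<epsilon> :: "nat \<Rightarrow> 'm"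
    and D :: "'m exterior \<Rightarrow> 'm exterior fps"
    and I :: "nat list"
    and h :: nat
  assumes "module scale"
    and "Z_basis scale \<epsilon>"
    and "schubert_derivation \<epsilon> D"
    and "length I \<ge> 1"
    and "\<forall>i\<in>set I. i \<ge> 1"
    and "sorted_wrt (<) I"
  shows "fps_nth (D (wedge (map \<epsilon> I))) h =
         (\<Sum>hs\<in>pieri_set I h. wedge (map \<epsilon> (map2 (+) I hs)))"
  using assms by (intro schubert_wedge_nth)

end
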